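(* Let $N_c,N_s$ be powers of two, $N_c,N_s\ge 2$, let $1\le K\le N_s$, and let $A=(a_{ij})\in\mathbb{R}^{N_c\times N_s}$ satisfy $\sum_{i,j}a_{ij}^2=1$. Let $\hat a_{ij}$ be the entries of the row-wise Fourier transform of $A$ and $\hat a^j=(\hat a_{ij})_{1\le i\le N_c}$. For each $k\in\{1,\dots,K\}$ let $P_k$ be a butterfly circuit on $N_c$ qubits with arbitrary $RBS$ angles, $P_k'$ the circuit with the same $RBS$ gates in reversed order, $W_{P_k},W_{P_k'}$ their matrices on the unary basis, $W_Q^k=W_{P_k'}W_{P_k}$, and $\hat b^k=W_Q^k\hat a^k$ with $i$-th entry $\hat b_{ik}$. Then the parallel quantum Fourier layer, which consists of $K$ independent circuits on $N_c+N_s$ qubits each, produces in its $k$-th circuit, for each $k=1,\dots,K$, the state $$\sum_{i=1}^{N_c}|e_i\rangle\; IQFT\Big(\hat b_{ik}|e_k\rangle+\sum_{j\ne k}\hat a_{ij}|e_j\rangle\Big),$$ and each of the $K$ circuits has depth $O\big(N_c+N_c\log N_s\big)$.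
   Context: **Unary states and gates.** On $n$ qubits, $|e_i\rangle$ is the computational basis state with a single $1$, on qubit $i$. $RBS(\theta)$ is the two-qubit gate fixing $|00\rangle,|11\rangle$ with $|01\rangle\mapsto\cos\theta|01\rangle-\sin\theta|10\rangle$ and $|10\rangle\mapsto\sin\theta|01\rangle+\cos\theta|10\rangle$; it preserves Hamming weight, so a circuit of $RBS$ gates restricts to a real orthogonal matrix on the span of the unary states. **Butterfly circuit.** On $N=2^a$ qubits labelled by $\{0,\dots,2^a-1\}$ in binary, it has $a$ layers of $RBS$ gates; in each layer one bit position is fixed (each position is used in exactly one layer, positions ordered as in the FFT butterfly) and an $RBS$ gate with its own angle is applied to every pair of qubits whose labels differ exactly in that bit. **Fourier transform.** For $x\in\mathbb{C}^M$, $\hat x_k=\frac1{\sqrt M}\sum_j\omega^{(j-1)(k-1)}x_j$ with $\omega=e^{2\pi i/M}$. For $M$ a power of two, the unary $QFT$ is a circuit on $M$ qubits of depth $O(\log M)$ with $\sum_j x_j|e_j\rangle\mapsto\sum_j\hat x_j|e_j\rangle$ (a fixed relabelling of the input qubits is free); $IQFT$ is its inverse. **Parallel quantum Fourier layer.** The $k$-th circuit has an upper register of $N_c$ qubits and a lower register of $N_s$ qubits, starts in $|0\rangle^{\otimes N_c}\otimes|0\rangle^{\otimes N_s}$, and consists of: 1. a loading circuit producing $\sum_{i,j}a_{ij}|e_i\rangle|e_j\rangle$ (assumed known to exist with depth $O(\log N_c+N_c\log N_s)$); 2. the unary $QFT$ on the lower register; 3. on the upper register: $P_k$; then $CU_Z$;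 then $P_k'$; then $CU_Z$ again, where $U_Z$ is the product of Pauli $Z$ gates on a set of upper qubits chosen so that every $RBS$ gate of $P_k$ acts on exactly one qubit of the set, and $CU_Z$ applies $U_Z$ if the $k$-th lower qubit is $|0\rangle$ and does nothing if it is $|1\rangle$ (implemented by at most $N_c$ controlled-$Z$ gates, plus $X$ gates on the control); 4. the unary $IQFT$ on the lower register. All-to-all connectivity is assumed; depth is the number of layers when gates on disjoint qubits are executed in parallel. *)

theory Defs
  imports
    "Jordan_Normal_Form.Schur_Decomposition"
    "HOL-Combinatorics.Permutations"
begin

section \<open>States, gates and circuits\<close>

text \<open>
  A computational basis state of a register with qubits of type \<open>'q\<close> is identified with the set of
  qubits that are in state 1, and a (pure) state with its amplitude function.  In particular the
  unary state \<open>|e\<^sub>i\<rangle>\<close> is \<open>ket {i}\<close> and \<open>|0...0\<rangle>\<close> is \<open>ket {}\<close>.  Qubits are numbered from 0.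
\<close>

type_synonym 'q state = "'q set \<Rightarrow> complex"

definition ket :: "'q set \<Rightarrow> 'q state" where
  "ket S = (\<lambda>T. if T = S then 1 else 0)"

definition unary_state :: "complex vec \<Rightarrow> nat state" where
  "unary_state x = (\<lambda>S. \<Sum>j<dim_vec x. x $ j * ket {j} S)"

text \<open>\<open>Inl\<close> labels the upper register, \<open>Inr\<close> the lower one.\<close>

definition tensor :: "'p state \<Rightarrow> 'q state \<Rightarrow> ('p + 'q) state" where
  "tensor \<phi> \<psi> = (\<lambda>S. \<phi> (Inl -` S) * \<psi> (Inr -` S))"

datatype 'q gate = Gate (qubits: "'q list") (gate_mat: "complex mat")

text \<open>
  Position of a basis state of the qubits \<open>qs\<close> in the usual ordering of the computational basis,
  the first qubit being the most significant: 00, 01, 10, 11 for two qubits.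
\<close>

fun basis_index :: "'q list \<Rightarrow> 'q set \<Rightarrow> nat" where
  "basis_index [] S = 0"
| "basis_index (q # qs) S = of_bool (q \<in> S) * 2 ^ length qs + basis_index qs S"

definition apply_gate :: "'q gate \<Rightarrow> 'q state \<Rightarrow> 'q state" where
  "apply_gate g \<psi> = (\<lambda>S. \<Sum>T\<in>Pow (set (qubits g)).
     gate_mat g $$ (basis_index (qubits g) S, basis_index (qubits g) T)
       * \<psi> ((S - set (qubits g)) \<union> T))"

definition unitary_mat :: "nat \<Rightarrow> complex mat \<Rightarrow> bool" where
  "unitary_mat n U \<longleftrightarrow> U \<in> carrier_mat n n \<and> U * mat_adjoint U = 1\<^sub>m n"

text \<open>The elementary gates are all one- and two-qubit unitaries.\<close>

definition valid_gate :: "'q set \<Rightarrow> 'q gate \<Rightarrow> bool" where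
  "valid_gate Q g \<longleftrightarrow> set (qubits g) \<subseteq> Q \<and> distinct (qubits g)
     \<and> length (qubits g) \<in> {1, 2} \<and> unitary_mat (2 ^ length (qubits g)) (gate_mat g)"

text \<open>
  A circuit is a sequence of gates, interspersed with relabellings, which move the content of
  qubit \<open>q\<close> to qubit \<open>\<pi> q\<close> and cost no depth.  The latter occur only in the Fourier transform.
\<close>

datatype 'q instr = Op "'q gate" | Relabel "'q \<Rightarrow> 'q"

type_synonym 'q circuit = "'q instr list"

fun valid_instr :: "'q set \<Rightarrow> 'q instr \<Rightarrow> bool" where
  "valid_instr Q (Op g) \<longleftrightarrow> valid_gate Q g"
| "valid_instr Q (Relabel \<pi>) \<longleftrightarrow> \<pi> permutes Q"

definition valid_circuit :: "'q set \<Rightarrow> 'q circuit \<Rightarrow> bool" where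
  "valid_circuit Q c \<longleftrightarrow> (\<forall>x\<in>set c. valid_instr Q x)"

fun apply_instr :: "'q instr \<Rightarrow> 'q state \<Rightarrow> 'q state" where
  "apply_instr (Op g) \<psi> = apply_gate g \<psi>"
| "apply_instr (Relabel \<pi>) \<psi> = (\<lambda>S. \<psi> (\<pi> -` S))"

definition run :: "'q circuit \<Rightarrow> 'q state \<Rightarrow> 'q state" where
  "run c \<psi> = fold apply_instr c \<psi>"

fun inverse_instr :: "'q instr \<Rightarrow> 'q instr" where
  "inverse_instr (Op g) = Op (Gate (qubits g) (mat_adjoint (gate_mat g)))"
| "inverse_instr (Relabel \<pi>) = Relabel (inv_into UNIV \<pi>)"

definition inverse_circuit :: "'q circuit \<Rightarrow> 'q circuit" where
  "inverse_circuit c = rev (map inverse_instr c)"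

text \<open>
  Depth is the number of layers of the as-soon-as-possible schedule: \<open>finish_times c t q\<close> is the
  layer in which qubit \<open>q\<close> is last used by \<open>c\<close>, if it was last used in layer \<open>t q\<close> before.
\<close>

fun finish_times :: "'q circuit \<Rightarrow> ('q \<Rightarrow> nat) \<Rightarrow> 'q \<Rightarrow> nat" where
  "finish_times [] t = t"
| "finish_times (Op g # c) t = finish_times c
     (\<lambda>q. if q \<in> set (qubits g) then Suc (Max (t ` set (qubits g))) else t q)"
| "finish_times (Relabel \<pi> # c) t = finish_times c (t \<circ> inv_into UNIV \<pi>)"

definition depth :: "'q circuit \<Rightarrow> nat" where
  "depth c = (SUP q. finish_times c (\<lambda>_. 0) q)"

text \<open>Placing a circuit on one of two registers.\<close>

definition on_upper :: "nat gate list \<Rightarrow> (nat + nat) circuit" where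
  "on_upper gs = map (\<lambda>g. Op (map_gate Inl g)) gs"

fun lower_instr :: "nat instr \<Rightarrow> (nat + nat) instr" where
  "lower_instr (Op g) = Op (map_gate Inr g)"
| "lower_instr (Relabel \<pi>) = Relabel (map_sum id \<pi>)"

definition on_lower :: "nat circuit \<Rightarrow> (nat + nat) circuit" where
  "on_lower c = map lower_instr c"

section \<open>Particular gates and butterfly circuits\<close>

definition rbs :: "real \<Rightarrow> 'q \<Rightarrow> 'q \<Rightarrow> 'q gate" where
  "rbs \<theta> p q = Gate [p, q] (mat_of_rows_list 4 (map (map complex_of_real)
     [[1,        0,      0, 0],
      [0,    cos \<theta>,  sin \<theta>, 0],
      [0, - (sin \<theta>), cos \<theta>, 0],
      [0,        0,      0, 1]]))"

definition pauli_x :: "'q \<Rightarrow> 'q gate" where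
  "pauli_x q = Gate [q] (mat_of_rows_list 2 [[0, 1], [1, 0]])"

definition cz :: "'q \<Rightarrow> 'q \<Rightarrow> 'q gate" where
  "cz p q = Gate [p, q] (mat_of_rows_list 4
     [[1, 0, 0, 0], [0, 1, 0, 0], [0, 0, 1, 0], [0, 0, 0, -1]])"

text \<open>
  \<open>flip_bit t i\<close> is the label that differs from \<open>i\<close> exactly in bit \<open>t\<close>.  Exchanging the two qubits
  of an RBS gate amounts to negating its angle, so the smaller label can be put first.
\<close>

definition butterfly_layer :: "nat \<Rightarrow> nat \<Rightarrow> (nat \<Rightarrow> real) \<Rightarrow> nat gate list" where
  "butterfly_layer a t \<theta> = [rbs (\<theta> i) i (flip_bit t i). i \<leftarrow> [0..<2 ^ a], i < flip_bit t i]"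

text \<open>
  Both orders of the bit positions that are in use for the FFT butterfly are admitted: increasing
  strides (decimation in time) and decreasing strides (decimation in frequency).
\<close>

definition is_butterfly :: "nat \<Rightarrow> nat gate list \<Rightarrow> bool" where
  "is_butterfly N gs \<longleftrightarrow> (\<exists>a ts \<theta>. N = 2 ^ a \<and> (ts = [0..<a] \<or> ts = rev [0..<a])
     \<and> gs = concat (map (\<lambda>t. butterfly_layer a t (\<theta> t)) ts))"

definition unary_matrix :: "nat \<Rightarrow> nat gate list \<Rightarrow> complex mat" where
  "unary_matrix N gs = mat N N (\<lambda>(i, j). run (map Op gs) (ket {j}) {i})"

section \<open>Fourier transform and loading\<close>

definition fourier :: "complex vec \<Rightarrow> complex vec" where
  "fourier x = vec (dim_vec x) (\<lambda>k.
     (\<Sum>j<dim_vec x. cis (2 * pi / real (dim_vec x)) ^ (j * k) * x $ j)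
       / complex_of_real (sqrt (real (dim_vec x))))"

definition row_fourier :: "real mat \<Rightarrow> complex mat" where
  "row_fourier A = mat_of_rows (dim_col A)
     (map (\<lambda>r. fourier (map_vec complex_of_real r)) (rows A))"

text \<open>Only the input qubits may be relabelled.\<close>

definition is_unary_qft :: "nat \<Rightarrow> nat circuit \<Rightarrow> bool" where
  "is_unary_qft M c \<longleftrightarrow> (\<exists>\<pi> gs. c = Relabel \<pi> # map Op gs) \<and> valid_circuit {..<M} c
     \<and> (\<forall>x\<in>carrier_vec M. run c (unary_state x) = unary_state (fourier x))"

definition is_loading_circuit :: "real mat \<Rightarrow> (nat + nat) gate list \<Rightarrow> bool" where
  "is_loading_circuit A gs \<longleftrightarrow>
     valid_circuit ({..<dim_row A} <+> {..<dim_col A}) (map Op gs)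
     \<and> run (map Op gs) (ket {}) = (\<lambda>S. \<Sum>i<dim_row A. \<Sum>j<dim_col A.
          complex_of_real (A $$ (i, j)) * tensor (ket {i}) (ket {j}) S)"

section \<open>The parallel quantum Fourier layer\<close>

definition splits_gates :: "nat set \<Rightarrow> nat gate list \<Rightarrow> bool" where
  "splits_gates Z gs \<longleftrightarrow> (\<forall>g\<in>set gs. card (set (qubits g) \<inter> Z) = 1)"

text \<open>
  \<open>U\<^sub>Z\<close> on the upper qubits in \<open>Z\<close>, controlled on lower qubit \<open>k\<close> being in state 0.
\<close>

definition controlled_uz :: "nat \<Rightarrow> nat set \<Rightarrow> (nat + nat) circuit" where
  "controlled_uz k Z = [Op (pauli_x (Inr k))]
     @ map (\<lambda>i. Op (cz (Inr k) (Inl i))) (sorted_list_of_set Z)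
     @ [Op (pauli_x (Inr k))]"

definition pqf_circuit ::
  "(nat + nat) gate list \<Rightarrow> nat circuit \<Rightarrow> nat gate list \<Rightarrow> nat set \<Rightarrow> nat \<Rightarrow> (nat + nat) circuit"
where
  "pqf_circuit load qft P Z k =
     map Op load
     @ on_lower qft
     @ on_upper P @ controlled_uz k Z @ on_upper (rev P) @ controlled_uz k Z
     @ on_lower (inverse_circuit qft)"

text \<open>The \<open>K\<close> circuits act on separate copies of the two registers.\<close>

definition pqf_layer ::
  "(nat + nat) gate list \<Rightarrow> nat circuit \<Rightarrow> (nat \<Rightarrow> nat gate list) \<Rightarrow> (nat \<Rightarrow> nat set) \<Rightarrow> nat
     \<Rightarrow> (nat + nat) circuit list"
where
  "pqf_layer load qft P Z K = map (\<lambda>k. pqf_circuit load qft (P k) (Z k) k) [0..<K]"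

section \<open>Consistency of the definitions\<close>

text \<open>Every butterfly circuit admits a splitting set: the labels of odd binary weight.\<close>

lemma butterfly_splits:
  assumes "is_butterfly N gs"
  shows "\<exists>Z\<subseteq>{..<N}. splits_gates Z gs"
proof -
  define w :: "nat \<Rightarrow> bool" where "w i = odd (card {t. bit i t})" for i
  from assms obtain a ts \<theta> where N: "N = 2 ^ a" and order: "ts = [0..<a] \<or> ts = rev [0..<a]"
    and gs: "gs = concat (map (\<lambda>t. butterfly_layer a t (\<theta> t)) ts)"
    unfolding is_butterfly_def by blast
  from order have ts: "set ts = {..<a}" by auto
  have fin: "finite {t. bit i t}" for i :: nat
  proof (rule finite_subset)
    show "{t. bit i t} \<subseteq> {..<i}"
    proof
      fix t assume "t \<in> {t. bit i t}"
      then have "i div 2 ^ t \<noteq> 0" by (intro notI) (simp add: bit_iff_odd)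
      then have "2 ^ t \<le> i" using div_less[of i "2 ^ t"] by linarith
      then show "t \<in> {..<i}" using less_le_trans[OF less_exp] by simp
    qed
  qed simp
  have bits: "{s. bit (flip_bit t i) s}
      = (if bit i t then {s. bit i s} - {t} else insert t {s. bit i s})" for t i :: nat
    by (auto simp: bit_flip_bit_iff)
  have flip: "w (flip_bit t i) \<longleftrightarrow> \<not> w i" for t i :: nat
  proof (cases "bit i t")
    case True
    then have "Suc (card ({s. bit i s} - {t})) = card {s. bit i s}"
      by (intro card_Suc_Diff1 fin) simp
    then have "odd (card ({s. bit i s} - {t})) \<longleftrightarrow> even (card {s. bit i s})"
      by (metis even_Suc)
    then show ?thesis using True unfolding w_def bits by simp
  next
    case False
    then show ?thesis using fin[of i] by (simp add: w_def bits)
  qed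
  have bound: "flip_bit t i < 2 ^ a" if "i < 2 ^ a" "t < a" for t i :: nat
  proof -
    have "s < a" if "bit i s" for s
    proof -
      have "bit (take_bit a i) s" unfolding take_bit_nat_eq_self[OF \<open>i < 2 ^ a\<close>] by fact
      then show ?thesis unfolding bit_take_bit_iff by blast
    qed
    then have "take_bit a (flip_bit t i) = flip_bit t i"
      using \<open>t < a\<close> by (intro bit_eqI) (auto simp: bit_take_bit_iff bit_flip_bit_iff)
    then show ?thesis by (simp add: take_bit_nat_eq_self_iff)
  qed
  have "splits_gates {i. i < N \<and> w i} gs"
    unfolding splits_gates_def
  proof
    fix g assume "g \<in> set gs"
    then obtain t i where t: "t < a" and i: "i < 2 ^ a" "i < flip_bit t i"
      and g: "g = rbs (\<theta> t i) i (flip_bit t i)"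
      unfolding gs set_concat set_map ts butterfly_layer_def by fastforce
    have "set (qubits g) \<inter> {i. i < N \<and> w i} = (if w i then {i} else {flip_bit t i})"
      using flip[of t i] bound[OF i(1) t] i(1) N by (auto simp: g rbs_def)
    then show "card (set (qubits g) \<inter> {i. i < N \<and> w i}) = 1" by simp
  qed
  then show ?thesis by (intro exI[of _ "{i. i < N \<and> w i}"]) auto
qed

lemma apply_pauli_x: "apply_gate (pauli_x q) \<psi> S = \<psi> (if q \<in> S then S - {q} else insert q S)"
  by (auto simp: apply_gate_def pauli_x_def mat_of_rows_list_def Pow_insert insert_absorb)

lemma apply_two_qubit_gate:
  assumes "p \<noteq> q"
  shows "apply_gate (Gate [p, q] U) \<psi> S =
     (\<lambda>r R. U $$ (r, 0) * \<psi> R + U $$ (r, 1) * \<psi> (insert q R)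
        + U $$ (r, 2) * \<psi> (insert p R) + U $$ (r, 3) * \<psi> (insert p (insert q R)))
     (of_bool (p \<in> S) * 2 + of_bool (q \<in> S)) (S - {p, q})"
proof -
  have "Pow {p, q} = {{}, {q}, {p}, {p, q}}" by auto
  moreover have "{} \<noteq> {q}" "{} \<noteq> {p}" "{} \<noteq> {p, q}" "{q} \<noteq> {p}" "{q} \<noteq> {p, q}" "{p} \<noteq> {p, q}"
    using assms by auto
  ultimately show ?thesis using assms by (simp add: apply_gate_def)
qed

lemma apply_cz:
  assumes "p \<noteq> q"
  shows "apply_gate (cz p q) \<psi> S = (if p \<in> S \<and> q \<in> S then - \<psi> S else \<psi> S)"
proof -
  have "p \<in> S \<Longrightarrow> q \<in> S \<Longrightarrow> insert p (insert q (S - {p, q})) = S"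
    "p \<in> S \<Longrightarrow> q \<notin> S \<Longrightarrow> insert p (S - {p, q}) = S"
    "p \<notin> S \<Longrightarrow> q \<in> S \<Longrightarrow> insert q (S - {p, q}) = S"
    "p \<notin> S \<Longrightarrow> q \<notin> S \<Longrightarrow> S - {p, q} = S" by auto
  then show ?thesis
    by (cases "p \<in> S"; cases "q \<in> S")
       (simp_all add: apply_two_qubit_gate[OF assms] cz_def mat_of_rows_list_def numeral_2_eq_2 numeral_3_eq_3)
qed

lemma rbs_unary:
  assumes "p \<noteq> q"
  shows "apply_gate (rbs \<theta> p q) (ket {q})
      = (\<lambda>S. complex_of_real (cos \<theta>) * ket {q} S - complex_of_real (sin \<theta>) * ket {p} S)"
    and "apply_gate (rbs \<theta> p q) (ket {p})
      = (\<lambda>S. complex_of_real (sin \<theta>) * ket {q} S + complex_of_real (cos \<theta>) * ket {p} S)"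
proof -
  have k: "ket {q} R = 0" "ket {p} R = 0"
    "ket {q} (insert q R) = of_bool (R = {})" "ket {p} (insert q R) = 0"
    "ket {p} (insert p R) = of_bool (R = {})" "ket {q} (insert p R) = 0"
    "ket {p} (insert p (insert q R)) = 0" "ket {q} (insert p (insert q R)) = 0"
    if "R = S - {p, q}" for R S :: "'a set"
    using assms that by (auto simp: ket_def)
  have s: "ket {q} S = of_bool (q \<in> S \<and> p \<notin> S \<and> S - {p, q} = {})"
    "ket {p} S = of_bool (p \<in> S \<and> q \<notin> S \<and> S - {p, q} = {})" for S
    using assms by (auto simp: ket_def)
  show "apply_gate (rbs \<theta> p q) (ket {q})
      = (\<lambda>S. complex_of_real (cos \<theta>) * ket {q} S - complex_of_real (sin \<theta>) * ket {p} S)"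
    "apply_gate (rbs \<theta> p q) (ket {p})
      = (\<lambda>S. complex_of_real (sin \<theta>) * ket {q} S + complex_of_real (cos \<theta>) * ket {p} S)"
    unfolding rbs_def apply_two_qubit_gate[OF assms] k[OF refl] s fun_eq_iff
    by (simp_all add: mat_of_rows_list_def numeral_2_eq_2 numeral_3_eq_3)
qed

lemma run_controlled_uz:
  assumes "finite Z"
  shows "run (controlled_uz k Z) \<psi>
    = (\<lambda>S. (if Inr k \<in> S then 1 else (- 1) ^ card {i \<in> Z. Inl i \<in> S}) * \<psi> S)"
proof -
  have cz: "fold apply_instr (map (\<lambda>i. Op (cz (Inr k) (Inl i))) xs) \<phi>
      = (\<lambda>S. (if Inr k \<in> S then (- 1) ^ card {i \<in> set xs. Inl i \<in> S} else 1) * \<phi> S)"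
    if "distinct xs" for xs and \<phi> :: "(nat + nat) state"
    using that
  proof (induction xs arbitrary: \<phi>)
    case (Cons x xs)
    have "{i. (i = x \<or> i \<in> set xs) \<and> Inl i \<in> S}
        = (if Inl x \<in> S then insert x {i \<in> set xs. Inl i \<in> S} else {i \<in> set xs. Inl i \<in> S})"
      for S :: "(nat + nat) set" by auto
    then show ?case using Cons by (auto simp: fun_eq_iff apply_cz)
  qed auto
  show ?thesis
    using assms by (auto simp: run_def controlled_uz_def cz apply_pauli_x fun_eq_iff insert_absorb)
qed

end

theory Submission
  imports Defs
begin

text \<open>
  Group the state after the Fourier transform by the lower unary state.  On the summand with lower
  state \<open>e\<^sub>k\<close> both controlled gates are idle and the upper register undergoes the unary matrices of
  \<open>P\<close> and of its reversal.  On all other summands \<open>U\<^sub>Z\<close> is applied; since it anticommutes with the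
  off-diagonal part of every gate of \<open>P\<close>, conjugation by it turns the reversed circuit into the
  inverse of \<open>P\<close>, and the upper register is restored.  For the depth, the gates of a butterfly
  layer are disjoint, so \<open>P\<close> has depth at most \<open>log N\<^sub>c\<close>, and the controlled gates contribute
  at most \<open>N\<^sub>c + 2\<close> layers each.
\<close>

section \<open>Linearity and registers\<close>

text \<open>States are bare functions, so linearity is phrased with pointwise sums. For a gate it is
  an exchange of the sum over \<open>I\<close> with the sum over the basis states of the gate's
  qubits.\<close>

lemma apply_instr_sum:
  "apply_instr x (\<lambda>S. \<Sum>i\<in>I. c i * \<psi> i S) = (\<lambda>S. \<Sum>i\<in>I. c i * apply_instr x (\<psi> i) S)"
proof (cases x)
  case (Op g)
  show ?thesis unfolding Op apply_instr.simps apply_gate_def sum_distrib_left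
    by (subst sum.swap) (simp add: mult.left_commute)
qed simp

lemma run_Nil [simp]: "run [] \<psi> = \<psi>"
  and run_Cons [simp]: "run (x # c) \<psi> = run c (apply_instr x \<psi>)"
  and run_append [simp]: "run (c @ d) \<psi> = run d (run c \<psi>)"
  by (simp_all add: run_def)

lemma run_lincomb:
  "run c (\<lambda>S. \<Sum>i\<in>I. a i * \<psi> i S) = (\<lambda>S. \<Sum>i\<in>I. a i * run c (\<psi> i) S)"
  by (induction c arbitrary: \<psi>) (simp_all add: apply_instr_sum)

lemma run_sum: "run c (\<lambda>S. \<Sum>i\<in>I. \<psi> i S) = (\<lambda>S. \<Sum>i\<in>I. run c (\<psi> i) S)"
  using run_lincomb[of c "\<lambda>_. 1" \<psi> I] by simp

section \<open>Gates and circuits acting on one factor of a product state\<close>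

lemma basis_index_map: "basis_index (map f qs) S = basis_index qs (f -` S)"
  by (induction qs) auto

text \<open>Injectivity makes the subsets of the relabelled qubits correspond one to one to subsets
  of the original ones, so the sum can be reindexed by images. Both register embeddings are
  instances.\<close>

lemma apply_gate_map:
  assumes "inj f"
  shows "apply_gate (map_gate f g) \<psi> S = (\<Sum>T\<in>Pow (set (qubits g)).
     gate_mat g $$ (basis_index (qubits g) (f -` S), basis_index (qubits g) T)
       * \<psi> ((S - f ` set (qubits g)) \<union> f ` T))"
proof -
  have "inj_on ((`) f) (Pow (set (qubits g)))"
    using assms by (auto simp: inj_on_def inj_image_eq_iff)
  moreover have "Pow (f ` set (qubits g)) = (`) f ` Pow (set (qubits g))"
    by (simp add: image_Pow_surj)
  ultimately show ?thesis
    by (simp add: apply_gate_def gate.map_sel sum.reindex basis_index_map inj_vimage_image_eq assms)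
qed

text \<open>The gate alters only the upper part of a basis state, so the lower factor comes out of
  the sum over \<open>T\<close>.\<close>

lemma apply_gate_Inl:
  fixes \<phi> :: "'p state" and \<psi> :: "'q state"
  shows "apply_gate (map_gate Inl g) (tensor \<phi> \<psi>) = tensor (apply_gate g \<phi>) \<psi>"
proof
  fix S :: "('p + 'q) set"
  have "Inl -` ((S - Inl ` Q) \<union> Inl ` T) = (Inl -` S - Q) \<union> T"
    "Inr -` ((S - Inl ` Q) \<union> Inl ` T) = Inr -` S" for Q T by auto
  then show "apply_gate (map_gate Inl g) (tensor \<phi> \<psi>) S = tensor (apply_gate g \<phi>) \<psi> S"
    by (simp add: apply_gate_map tensor_def apply_gate_def[of g] sum_distrib_right mult.assoc)
qed

lemma apply_gate_Inr:
  fixes \<phi> :: "'p state" and \<psi> :: "'q state"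
  shows "apply_gate (map_gate Inr g) (tensor \<phi> \<psi>) = tensor \<phi> (apply_gate g \<psi>)"
proof
  fix S :: "('p + 'q) set"
  have "Inr -` ((S - Inr ` Q) \<union> Inr ` T) = (Inr -` S - Q) \<union> T"
    "Inl -` ((S - Inr ` Q) \<union> Inr ` T) = Inl -` S" for Q T by auto
  then show "apply_gate (map_gate Inr g) (tensor \<phi> \<psi>) S = tensor \<phi> (apply_gate g \<psi>) S"
    by (simp add: apply_gate_map tensor_def apply_gate_def[of g] sum_distrib_left mult.left_commute)
qed

lemma run_on_upper: "run (on_upper gs) (tensor \<phi> \<psi>) = tensor (run (map Op gs) \<phi>) \<psi>"
  by (induction gs arbitrary: \<phi>) (simp_all add: on_upper_def apply_gate_Inl)

lemma apply_lower_instr: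
  "apply_instr (lower_instr x) (tensor \<phi> \<psi>) = tensor \<phi> (apply_instr x \<psi>)"
proof (cases x)
  case (Relabel \<pi>)
  have "Inl -` map_sum id \<pi> -` S = Inl -` S" "Inr -` map_sum id \<pi> -` S = \<pi> -` Inr -` S" for S :: "(nat + nat) set"
    by auto
  then show ?thesis by (simp add: Relabel tensor_def)
qed (simp add: apply_gate_Inr)

lemma run_on_lower: "run (on_lower c) (tensor \<phi> \<psi>) = tensor \<phi> (run c \<psi>)"
  by (induction c arbitrary: \<psi>) (simp_all add: on_lower_def apply_lower_instr)

lemma tensor_lincomb_left:
  "tensor (\<lambda>S. \<Sum>i\<in>I. c i * \<phi> i S) \<psi> S = (\<Sum>i\<in>I. c i * tensor (\<phi> i) \<psi> S)"
  by (simp add: tensor_def sum_distrib_right mult.assoc)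

lemma tensor_lincomb_right:
  "tensor \<phi> (\<lambda>S. \<Sum>i\<in>I. c i * \<psi> i S) S = (\<Sum>i\<in>I. c i * tensor \<phi> (\<psi> i) S)"
  by (simp add: tensor_def sum_distrib_left mult.left_commute)

section \<open>RBS gates\<close>

text \<open>What the computation of the state uses of a butterfly circuit; the layer structure
  matters for the depth.\<close>

definition rbs_gates :: "nat \<Rightarrow> nat gate list \<Rightarrow> bool" where
  "rbs_gates N gs \<longleftrightarrow> (\<forall>g\<in>set gs. \<exists>\<theta> p q. p \<noteq> q \<and> p < N \<and> q < N \<and> g = rbs \<theta> p q)"

text \<open>The product of Pauli Z gates on \<open>Z\<close> is diagonal, with sign the parity of
  the excitations inside \<open>Z\<close>; this gives it directly on amplitudes.\<close>

definition uz :: "'q set \<Rightarrow> 'q state \<Rightarrow> 'q state" where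
  "uz Z \<psi> = (\<lambda>S. (- 1) ^ card {i \<in> Z. i \<in> S} * \<psi> S)"

lemma of_real_sin_squared:
  "complex_of_real (sin \<theta>) * complex_of_real (sin \<theta>)
    = 1 - complex_of_real (cos \<theta>) * complex_of_real (cos \<theta>)"
  by (metis sin_squared_eq power2_eq_square of_real_mult of_real_diff of_real_1)

text \<open>Only basis states with exactly one excitation on \<open>{p, q}\<close> mix. Writing the
  two amplitudes through \<open>S\<close> and its partner state avoids matrix indices from here
  on.\<close>

lemma apply_rbs:
  assumes "p \<noteq> q"
  shows "apply_gate (rbs \<theta> p q) \<psi> S =
    (if p \<in> S \<longleftrightarrow> q \<in> S then \<psi> S
     else if p \<in> S then complex_of_real (cos \<theta>) * \<psi> S
       - complex_of_real (sin \<theta>) * \<psi> (insert q (S - {p}))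
     else complex_of_real (cos \<theta>) * \<psi> S
       + complex_of_real (sin \<theta>) * \<psi> (insert p (S - {q})))"
proof -
  have "p \<in> S \<Longrightarrow> q \<in> S \<Longrightarrow> insert p (insert q (S - {p, q})) = S"
    "p \<in> S \<Longrightarrow> q \<notin> S \<Longrightarrow> insert p (S - {p, q}) = S"
    "p \<in> S \<Longrightarrow> q \<notin> S \<Longrightarrow> insert q (S - {p, q}) = insert q (S - {p})"
    "p \<notin> S \<Longrightarrow> q \<in> S \<Longrightarrow> insert q (S - {p, q}) = S"
    "p \<notin> S \<Longrightarrow> q \<in> S \<Longrightarrow> insert p (S - {p, q}) = insert p (S - {q})"
    "p \<notin> S \<Longrightarrow> q \<notin> S \<Longrightarrow> S - {p, q} = S" by auto
  then show ?thesis
    unfolding rbs_def apply_two_qubit_gate[OF assms]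
    by (cases "p \<in> S"; cases "q \<in> S")
       (simp_all add: mat_of_rows_list_def numeral_2_eq_2 numeral_3_eq_3)
qed

text \<open>Exactly one of \<open>p\<close> and \<open>q\<close> lies in \<open>Z\<close>, so moving
  the excitation from \<open>p\<close> to \<open>q\<close> changes the parity of the excitations in
  \<open>Z\<close> by one.\<close>

lemma uz_swap:
  assumes Z: "finite Z" "card ({p, q} \<inter> Z) = 1" and S: "p \<in> S" "q \<notin> S"
  shows "(- 1 :: 'a::ring_1) ^ card {i \<in> Z. i \<in> insert q (S - {p})} = - ((- 1) ^ card {i \<in> Z. i \<in> S})"
proof -
  have pq: "(p \<in> Z) \<noteq> (q \<in> Z)"
  proof -
    have "p \<noteq> q" using S by auto
    then show ?thesis using Z(2) by (cases "p \<in> Z"; cases "q \<in> Z") simp_all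
  qed
  \<comment> \<open>The excitations in \<open>Z\<close> away from both qubits; one of the two sets
    compared is \<open>R\<close>, the other has one more element.\<close>
  define R where "R = {i \<in> Z. i \<in> S - {p}}"
  have R: "finite R" "p \<notin> R" "q \<notin> R" using Z S by (auto simp: R_def)
  show ?thesis
  proof (cases "p \<in> Z")
    case True
    then have "{i \<in> Z. i \<in> S} = insert p R" "{i \<in> Z. i \<in> insert q (S - {p})} = R"
      using pq S by (auto simp: R_def)
    then show ?thesis using R by simp
  next
    case False
    then have "{i \<in> Z. i \<in> S} = R" "{i \<in> Z. i \<in> insert q (S - {p})} = insert q R"
      using pq S by (auto simp: R_def)
    then show ?thesis using R by simp
  qed
qed

text \<open>Conjugation by \<open>U\<^sub>Z\<close> negates the angle of an RBS gate.\<close>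

lemma rbs_uz_rbs:
  assumes "finite Z" "p \<noteq> q" "card ({p, q} \<inter> Z) = 1"
  shows "apply_gate (rbs \<theta> p q) (uz Z (apply_gate (rbs \<theta> p q) \<psi>)) = uz Z \<psi>"
proof
  fix S
  have card': "card ({q, p} \<inter> Z) = 1" using assms(3) by (simp add: insert_commute)
  consider "p \<in> S \<longleftrightarrow> q \<in> S" | "p \<in> S" "q \<notin> S" | "p \<notin> S" "q \<in> S" by blast
  then show "apply_gate (rbs \<theta> p q) (uz Z (apply_gate (rbs \<theta> p q) \<psi>)) S = uz Z \<psi> S"
  proof cases
    case 1
    then show ?thesis by (simp add: apply_rbs[OF assms(2)] uz_def)
  next
    case 2
    \<comment> \<open>\<open>S'\<close> is the state that the gate mixes with \<open>S\<close>, and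
      it carries the opposite sign. Hence the sine-cosine cross terms cancel and the diagonal terms
      add up to the squared cosine plus the squared sine.\<close>
    define S' where "S' = insert q (S - {p})"
    have S': "p \<notin> S'" "q \<in> S'" "insert p (S' - {q}) = S" using 2 assms(2) by (auto simp: S'_def)
    define z :: complex where "z = (- 1) ^ card {i \<in> Z. i \<in> S}"
    have "uz Z \<phi> S' = - z * \<phi> S'" for \<phi> :: "'a state"
      using uz_swap[OF assms(1,3) 2, where 'a = complex] by (simp only: uz_def z_def S'_def)
    moreover have "uz Z \<phi> S = z * \<phi> S" for \<phi> :: "'a state" by (simp add: uz_def z_def)
    ultimately show ?thesis using 2 S'
      by (simp add: apply_rbs[OF assms(2)] flip: S'_def) (simp add: algebra_simps of_real_sin_squared)
  next
    case 3
    define S' where "S' = insert p (S - {q})"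
    have S': "q \<notin> S'" "p \<in> S'" "insert q (S' - {p}) = S" using 3 assms(2) by (auto simp: S'_def)
    define z :: complex where "z = (- 1) ^ card {i \<in> Z. i \<in> S}"
    have "uz Z \<phi> S' = - z * \<phi> S'" for \<phi> :: "'a state"
      using uz_swap[OF assms(1) card' 3(2,1), where 'a = complex] by (simp only: uz_def z_def S'_def)
    moreover have "uz Z \<phi> S = z * \<phi> S" for \<phi> :: "'a state" by (simp add: uz_def z_def)
    ultimately show ?thesis using 3 S'
      by (simp add: apply_rbs[OF assms(2)] flip: S'_def) (simp add: algebra_simps of_real_sin_squared)
  qed
qed

text \<open>The circuit and its reversal are nested around \<open>uz\<close>: the induction
  hypothesis, applied to the state after the first gate, collapses the inner gates to
  \<open>uz\<close>, and then the two outer copies of that gate cancel by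
  \<open>rbs_uz_rbs\<close>.\<close>

lemma run_rev_uz_run:
  assumes "finite Z" "rbs_gates N gs" "splits_gates Z gs"
  shows "run (map Op (rev gs)) (uz Z (run (map Op gs) \<psi>)) = uz Z \<psi>"
  using assms(2,3)
proof (induction gs arbitrary: \<psi>)
  case (Cons g gs)
  then obtain \<theta> p q where g: "g = rbs \<theta> p q" "p \<noteq> q" by (auto simp: rbs_gates_def)
  moreover have "card ({p, q} \<inter> Z) = 1"
    using Cons.prems(2) by (simp add: splits_gates_def g rbs_def)
  ultimately have "apply_gate g (uz Z (apply_gate g \<psi>)) = uz Z \<psi>" for \<psi>
    using rbs_uz_rbs[OF assms(1)] by simp
  with Cons show ?case by (simp add: rbs_gates_def splits_gates_def)
qed simp

lemma uz_uz [simp]: "uz Z (uz Z \<psi>) = \<psi>"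
  by (simp add: uz_def)

section \<open>RBS circuits on the span of the unary states\<close>

definition unary_support :: "nat \<Rightarrow> nat state \<Rightarrow> bool" where
  "unary_support N \<psi> \<longleftrightarrow> (\<forall>S. \<psi> S \<noteq> 0 \<longrightarrow> (\<exists>i<N. S = {i}))"

lemma unary_support_rbs:
  assumes "unary_support N \<psi>" "p \<noteq> q" "p < N" "q < N"
  shows "unary_support N (apply_gate (rbs \<theta> p q) \<psi>)"
  unfolding unary_support_def
proof (intro allI impI)
  fix S assume nz: "apply_gate (rbs \<theta> p q) \<psi> S \<noteq> 0"
  have *: "\<exists>i<N. T = {i}" if "\<psi> T \<noteq> 0" for T
    using assms(1) that by (auto simp: unary_support_def)
  \<comment> \<open>An amplitude can also reach \<open>S\<close> from its partner state. That one is
    a singleton containing \<open>s\<close>, so nothing but \<open>r\<close> is left in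
    \<open>S\<close>. Both orientations of the gate are instances.\<close>
  have ex: "\<exists>i<N. S = {i}" if "r \<in> S" "s \<notin> S" "r \<noteq> s" "r < N" "\<psi> (insert s (S - {r})) \<noteq> 0" for r s
  proof -
    from *[OF that(5)] have "S - {r} = {}" using that(2) by auto
    then have "S = {r}" using that(1) by blast
    then show ?thesis using that(4) by blast
  qed
  show "\<exists>i<N. S = {i}"
  proof (cases "\<psi> S = 0")
    case True
    then show ?thesis using nz ex[of p q] ex[of q p] assms(2-4)
      by (auto simp: apply_rbs[OF assms(2)] split: if_splits)
  qed (use * in blast)
qed

lemma unary_support_run:
  assumes "rbs_gates N gs" "unary_support N \<psi>"
  shows "unary_support N (run (map Op gs) \<psi>)"
  using assms
proof (induction gs arbitrary: \<psi>)
  case (Cons g gs)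
  then have "unary_support N (apply_gate g \<psi>)"
    using unary_support_rbs by (auto simp: rbs_gates_def)
  with Cons show ?case by (simp add: rbs_gates_def)
qed simp

lemma unary_support_ket: "j < N \<Longrightarrow> unary_support N (ket {j})"
  by (simp add: unary_support_def ket_def)

lemma unary_support_expand:
  assumes "unary_support N \<psi>"
  shows "\<psi> = (\<lambda>S. \<Sum>i<N. \<psi> {i} * ket {i} S)"
proof
  fix S
  show "\<psi> S = (\<Sum>i<N. \<psi> {i} * ket {i} S)"
  proof (cases "\<exists>i<N. S = {i}")
    case True
    then show ?thesis by (auto simp: ket_def if_distrib cong: if_cong)
  next
    case False
    then have "\<psi> S = 0" using assms by (auto simp: unary_support_def)
    moreover have "ket {i} S = 0" if "i < N" for i using False that by (auto simp: ket_def)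
    ultimately show ?thesis by simp
  qed
qed

text \<open>\<open>unary_matrix\<close> records only the amplitudes at unary states. Since the image
  of each \<open>ket {j}\<close> is supported there, it is recovered from its column, and linearity
  gives the matrix-vector product.\<close>

lemma run_unary_state:
  assumes gs: "rbs_gates N gs" and x: "x \<in> carrier_vec N"
  shows "run (map Op gs) (unary_state x) = unary_state (unary_matrix N gs *\<^sub>v x)"
proof
  fix S
  let ?W = "\<lambda>i j. run (map Op gs) (ket {j}) {i}"
  have "run (map Op gs) (unary_state x) S = (\<Sum>j<N. x $ j * run (map Op gs) (ket {j}) S)"
    using x by (simp add: unary_state_def[abs_def] run_lincomb)
  also have "\<dots> = (\<Sum>j<N. x $ j * (\<Sum>i<N. ?W i j * ket {i} S))"
  proof (intro sum.cong refl)
    fix j assume "j \<in> {..<N}"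
    then have "unary_support N (run (map Op gs) (ket {j}))"
      by (intro unary_support_run[OF gs] unary_support_ket) simp
    from fun_cong[OF unary_support_expand[OF this]]
    show "x $ j * run (map Op gs) (ket {j}) S = x $ j * (\<Sum>i<N. ?W i j * ket {i} S)"
      by (rule arg_cong)
  qed
  also have "\<dots> = (\<Sum>i<N. (\<Sum>j<N. ?W i j * x $ j) * ket {i} S)"
    unfolding sum_distrib_left sum_distrib_right by (subst sum.swap) (simp add: mult_ac)
  also have "\<dots> = unary_state (unary_matrix N gs *\<^sub>v x) S"
    using x by (simp add: unary_state_def unary_matrix_def scalar_prod_def atLeast0LessThan)
  finally show "run (map Op gs) (unary_state x) S = unary_state (unary_matrix N gs *\<^sub>v x) S" .
qed

text \<open>In the lower state \<open>ket {j}\<close> the control qubit is 1 exactly when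
  \<open>j = k\<close>; at basis states with a different lower part both sides vanish.\<close>

lemma controlled_uz_tensor_ket:
  assumes "finite Z"
  shows "run (controlled_uz k Z) (tensor \<phi> (ket {j}))
    = tensor (if j = k then \<phi> else uz Z \<phi>) (ket {j})"
proof
  fix S :: "(nat + nat) set"
  have "Inr k \<in> S \<longleftrightarrow> j = k" if "Inr -` S = {j}"
    using that by auto
  then show "run (controlled_uz k Z) (tensor \<phi> (ket {j})) S
      = tensor (if j = k then \<phi> else uz Z \<phi>) (ket {j}) S"
    by (cases "Inr -` S = {j}") (simp_all add: run_controlled_uz[OF assms] tensor_def uz_def ket_def)
qed

section \<open>Depth\<close>

lemma finish_times_append: "finish_times (c @ d) t = finish_times d (finish_times c t)"
  by (induction c t rule: finish_times.induct) (simp_all add: comp_def)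

text \<open>Maxima and successors are monotone and commute with adding a constant, so a start
  delayed by at most \<open>B\<close> delays every finishing time by at most
  \<open>B\<close>.\<close>

lemma finish_times_shift:
  assumes "\<And>q. t q \<le> B + s q"
  shows "finish_times c t q \<le> B + finish_times c s q"
  using assms
proof (induction c arbitrary: s t)
  case (Cons x c)
  show ?case
  proof (cases x)
    case (Op g)
    have "Max (t ` set (qubits g)) \<le> B + Max (s ` set (qubits g))" if "q \<in> set (qubits g)" for q
    proof (rule Max.boundedI)
      fix m assume "m \<in> t ` set (qubits g)"
      then obtain p where p: "p \<in> set (qubits g)" "m = t p" by auto
      have "s p \<le> Max (s ` set (qubits g))" using p by simp
      then show "m \<le> B + Max (s ` set (qubits g))" using Cons.prems[of p] p by linarith
    qed (use that in auto)
    then show ?thesis using Cons.prems unfolding Op finish_times.simps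
      by (intro Cons.IH) simp
  next
    case (Relabel \<pi>)
    then show ?thesis using Cons.prems by (auto intro!: Cons.IH)
  qed
qed simp

lemma finish_times_le_length:
  assumes "\<And>q. t q \<le> B"
  shows "finish_times c t q \<le> B + length c"
  using assms
proof (induction c arbitrary: t B)
  case (Cons x c)
  show ?case
  proof (cases x)
    case (Op g)
    have "Max (t ` set (qubits g)) \<le> B" if "q \<in> set (qubits g)" for q
      using that Cons.prems by (intro Max.boundedI) auto
    then have "finish_times (x # c) t q \<le> Suc B + length c"
      using Cons.prems unfolding Op finish_times.simps
      by (intro Cons.IH) (auto intro: le_SucI)
    then show ?thesis by simp
  next
    case (Relabel \<pi>)
    have "finish_times (x # c) t q \<le> B + length c"
      using Cons.prems unfolding Relabel finish_times.simps by (intro Cons.IH) simp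
    then show ?thesis by simp
  qed
qed simp

text \<open>\<open>depth\<close> is a supremum of naturals over a possibly infinite type of qubits,
  so boundedness has to be shown first; the length of the circuit is a bound.\<close>

lemma finish_times_le_depth: "finish_times c (\<lambda>_. 0) q \<le> depth c"
  unfolding depth_def
proof (rule cSUP_upper)
  show "bdd_above (range (finish_times c (\<lambda>_. 0)))"
    using finish_times_le_length[of "\<lambda>_. 0" 0 c] by (intro bdd_aboveI2[of _ _ "length c"]) simp
qed simp

lemma depth_leI: "(\<And>q. finish_times c (\<lambda>_. 0) q \<le> d) \<Longrightarrow> depth c \<le> d"
  unfolding depth_def by (rule cSUP_least) auto

lemma depth_le_length: "depth c \<le> length c"
  using finish_times_le_length[of "\<lambda>_. 0" 0 c] by (intro depth_leI) simp

text \<open>After \<open>c\<close> every qubit is free by layer \<open>depth c\<close>; running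
  \<open>d\<close> from there is covered by the shift lemma.\<close>

lemma depth_append: "depth (c @ d) \<le> depth c + depth d"
proof (rule depth_leI)
  fix q
  have "finish_times (c @ d) (\<lambda>_. 0) q \<le> depth c + finish_times d (\<lambda>_. 0) q"
    unfolding finish_times_append by (rule finish_times_shift) (simp add: finish_times_le_depth)
  also have "\<dots> \<le> depth c + depth d" by (simp add: finish_times_le_depth)
  finally show "finish_times (c @ d) (\<lambda>_. 0) q \<le> depth c + depth d" .
qed

section \<open>Depth of inverted and reversed circuits\<close>

lemma Suc_Max_image_add_le_iff:
  fixes f :: "'a \<Rightarrow> nat"
  assumes "finite Q" "Q \<noteq> {}"
  shows "Suc (Max (f ` Q)) + n \<le> d \<longleftrightarrow> (\<forall>p\<in>Q. Suc (f p + n) \<le> d)"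
proof
  assume *: "Suc (Max (f ` Q)) + n \<le> d"
  show "\<forall>p\<in>Q. Suc (f p + n) \<le> d"
  proof
    fix p assume "p \<in> Q"
    then have "f p \<le> Max (f ` Q)" using assms by simp
    then show "Suc (f p + n) \<le> d" using * by linarith
  qed
next
  assume *: "\<forall>p\<in>Q. Suc (f p + n) \<le> d"
  have "Max (f ` Q) \<in> f ` Q" using assms by (intro Max_in) auto
  then show "Suc (Max (f ` Q)) + n \<le> d" using * by auto
qed

text \<open>
  In the max-plus semiring \<open>finish_times c\<close> is a linear map, and that of the inverse circuit is
  its transpose; this is why reversing a circuit does not change its depth.
\<close>

lemma finish_times_inverse:
  assumes "\<And>\<pi>. Relabel \<pi> \<in> set c \<Longrightarrow> bij \<pi>"
  shows "(\<forall>q. finish_times c t q + u q \<le> d)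
    \<longleftrightarrow> (\<forall>q. t q + finish_times (inverse_circuit c) u q \<le> d)"
  using assms
proof (induction c arbitrary: t)
  case Nil
  then show ?case by (simp add: inverse_circuit_def)
next
  case (Cons x c)
  let ?v = "finish_times (inverse_circuit c) u"
  have inv: "finish_times (inverse_circuit (x # c)) u = finish_times [inverse_instr x] ?v"
    by (simp add: inverse_circuit_def finish_times_append)
  have IH: "(\<forall>q. finish_times c s q + u q \<le> d) \<longleftrightarrow> (\<forall>q. s q + ?v q \<le> d)" for s
    using Cons by simp
  show ?case
  proof (cases x)
    case (Op g)
    define Q where "Q = set (qubits g)"
    \<comment> \<open>A bound on a maximum is a family of bounds on its members. \<open>Q\<close>
      unfolds the maximum of \<open>t\<close>, and its commuted form \<open>Q'\<close> later folds
      the maximum of \<open>?v\<close>.\<close>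
    have Q: "Suc (Max (f ` Q)) + n \<le> d \<longleftrightarrow> (\<forall>p\<in>Q. Suc (f p + n) \<le> d)" if "q \<in> Q" for f n q
      using that by (intro Suc_Max_image_add_le_iff) (auto simp: Q_def)
    have Q': "n + Suc (Max (f ` Q)) \<le> d \<longleftrightarrow> (\<forall>p\<in>Q. Suc (f p + n) \<le> d)" if "q \<in> Q" for f n q
      using Q[OF that, of f n] by (simp add: add.commute)
    have "(\<forall>q. finish_times (x # c) t q + u q \<le> d)
        \<longleftrightarrow> (\<forall>q. (if q \<in> Q then Suc (Max (t ` Q)) else t q) + ?v q \<le> d)"
      unfolding Op finish_times.simps IH by (simp add: Q_def)
    also have "\<dots> \<longleftrightarrow> (\<forall>q. q \<notin> Q \<longrightarrow> t q + ?v q \<le> d) \<and> (\<forall>q\<in>Q. Suc (Max (t ` Q)) + ?v q \<le> d)"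
      by auto
    also have "\<dots> \<longleftrightarrow> (\<forall>q. q \<notin> Q \<longrightarrow> t q + ?v q \<le> d) \<and> (\<forall>q\<in>Q. \<forall>p\<in>Q. Suc (t p + ?v q) \<le> d)"
      by (intro conj_cong ball_cong refl Q)
    \<comment> \<open>The transposition itself: the condition ranges over all pairs from
      \<open>Q\<close>, so \<open>p\<close> and \<open>q\<close> may exchange roles.\<close>
    also have "\<dots> \<longleftrightarrow> (\<forall>q. q \<notin> Q \<longrightarrow> t q + ?v q \<le> d) \<and> (\<forall>q\<in>Q. \<forall>p\<in>Q. Suc (?v p + t q) \<le> d)"
      by (auto simp: add.commute)
    also have "\<dots> \<longleftrightarrow> (\<forall>q. q \<notin> Q \<longrightarrow> t q + ?v q \<le> d) \<and> (\<forall>q\<in>Q. t q + Suc (Max (?v ` Q)) \<le> d)"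
      by (intro conj_cong ball_cong refl Q'[symmetric])
    also have "\<dots> \<longleftrightarrow> (\<forall>q. t q + (if q \<in> Q then Suc (Max (?v ` Q)) else ?v q) \<le> d)"
      by auto
    also have "\<dots> \<longleftrightarrow> (\<forall>q. t q + finish_times (inverse_circuit (x # c)) u q \<le> d)"
      unfolding inv by (simp add: Op Q_def)
    finally show ?thesis .
  next
    case (Relabel \<pi>)
    then have bij: "bij \<pi>" using Cons.prems by simp
    \<comment> \<open>Substitution of \<open>\<pi> q\<close> for \<open>q\<close>, legitimate
      because \<open>\<pi>\<close> is a bijection.\<close>
    have "(\<forall>q. t (inv_into UNIV \<pi> q) + ?v q \<le> d) \<longleftrightarrow> (\<forall>q. t q + ?v (\<pi> q) \<le> d)"
      using bij by (metis bij_inv_eq_iff)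
    then show ?thesis unfolding inv
      by (simp add: Relabel IH inv_inv_eq[OF bij])
  qed
qed

text \<open>With zero vectors on both sides, the duality says that the two schedules have the same
  upper bounds; it is applied to \<open>d = depth c\<close>.\<close>

lemma depth_inverse_circuit:
  assumes "\<And>\<pi>. Relabel \<pi> \<in> set c \<Longrightarrow> bij \<pi>"
  shows "depth (inverse_circuit c) \<le> depth c"
  using finish_times_inverse[OF assms, of c "\<lambda>_. 0" "\<lambda>_. 0" "depth c"]
  by (intro depth_leI) (simp add: finish_times_le_depth)

text \<open>Inverting a gate changes its matrix but not its qubits, so the schedule of the reversed
  circuit is that of the inverse circuit.\<close>

lemma depth_rev:
  fixes gs :: "'q gate list"
  shows "depth (map Op (rev gs)) \<le> depth (map Op gs)"
proof -
  have "finish_times (map (inverse_instr \<circ> Op) hs) t = finish_times (map Op hs) t"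
    for hs :: "'q gate list" and t
    by (induction hs arbitrary: t) (simp_all cong: if_cong)
  then have "depth (map Op (rev gs)) = depth (inverse_circuit (map Op gs))"
    by (simp add: depth_def inverse_circuit_def rev_map)
  also have "\<dots> \<le> depth (map Op gs)" by (rule depth_inverse_circuit) auto
  finally show ?thesis .
qed

section \<open>Depth of a circuit placed on one of two registers\<close>

lemma finish_times_on_upper:
  "finish_times (on_upper gs) t (Inl q) = finish_times (map Op gs) (t \<circ> Inl) q"
  "finish_times (on_upper gs) t (Inr r) = t (Inr r)"
proof (induction gs arbitrary: t)
  case (Cons g gs)
  case 1
  show ?case using Cons
    by (simp add: on_upper_def gate.map_sel image_iff image_image comp_def cong: if_cong)
  case 2
  show ?case using Cons by (simp add: on_upper_def gate.map_sel image_iff)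
qed (simp_all add: on_upper_def comp_def)

lemma depth_on_upper: "depth (on_upper gs) \<le> depth (map Op gs)"
proof (rule depth_leI)
  fix q :: "nat + nat"
  show "finish_times (on_upper gs) (\<lambda>_. 0) q \<le> depth (map Op gs)"
    by (cases q) (simp_all add: finish_times_on_upper comp_def finish_times_le_depth)
qed

text \<open>\<open>finish_times\<close> treats a relabelling through its inverse, so the inverse of
  a lifted relabelling must be identified as a lift.\<close>

lemma inv_map_sum_id:
  assumes "bij \<pi>"
  shows "inv_into UNIV (map_sum id \<pi>) = map_sum id (inv_into UNIV \<pi>)"
proof (rule inv_equality)
  show "map_sum id (inv_into UNIV \<pi>) (map_sum id \<pi> x) = x" for x :: "'c + 'a"
    using bij_is_inj[OF assms] by (cases x) simp_all
  show "map_sum id \<pi> (map_sum id (inv_into UNIV \<pi>) y) = y" for y :: "'c + 'b"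
    using bij_is_surj[OF assms] by (cases y) (simp_all add: surj_f_inv_f)
qed

lemma finish_times_on_lower:
  assumes "\<And>\<pi>. Relabel \<pi> \<in> set c \<Longrightarrow> bij \<pi>"
  shows "finish_times (on_lower c) t (Inr q) = finish_times c (t \<circ> Inr) q
    \<and> finish_times (on_lower c) t (Inl r) = t (Inl r)"
  using assms
proof (induction c arbitrary: t)
  case (Cons x c)
  have IH: "finish_times (on_lower c) s (Inr q) = finish_times c (s \<circ> Inr) q"
    "finish_times (on_lower c) s (Inl r) = s (Inl r)" for s
    using Cons by (simp_all add: comp_def)
  show ?case
  proof (cases x)
    case (Op g)
    show ?thesis using IH
      by (simp add: Op on_lower_def gate.map_sel image_iff image_image comp_def cong: if_cong)
  next
    case (Relabel \<pi>)
    then have "inv_into UNIV (map_sum id \<pi> :: nat + nat \<Rightarrow> _) = map_sum id (inv_into UNIV \<pi>)"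
      using Cons.prems by (intro inv_map_sum_id) simp
    then show ?thesis using IH by (simp add: Relabel on_lower_def comp_def)
  qed
qed (simp add: on_lower_def)

lemma depth_on_lower:
  assumes "\<And>\<pi>. Relabel \<pi> \<in> set c \<Longrightarrow> bij \<pi>"
  shows "depth (on_lower c) \<le> depth c"
proof (rule depth_leI)
  fix q :: "nat + nat"
  show "finish_times (on_lower c) (\<lambda>_. 0) q \<le> depth c"
    using assms by (cases q) (simp_all add: finish_times_on_lower comp_def finish_times_le_depth)
qed

section \<open>Butterfly circuits\<close>

text \<open>The invariant separates qubits awaiting a gate, still at most at \<open>B\<close>, from
  the others, which may have reached \<open>Suc B\<close>. Disjointness keeps each executed gate
  from delaying a later one.\<close>

lemma finish_times_disjoint_gates:
  assumes "sorted_wrt (\<lambda>g h. set (qubits g) \<inter> set (qubits h) = {}) gs"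
    and "\<And>q. t q \<le> Suc B" and "\<And>g q. g \<in> set gs \<Longrightarrow> q \<in> set (qubits g) \<Longrightarrow> t q \<le> B"
  shows "finish_times (map Op gs) t q \<le> Suc B"
  using assms
proof (induction gs arbitrary: t)
  case (Cons g gs)
  have "Max (t ` set (qubits g)) \<le> B" if "q \<in> set (qubits g)" for q
    using that Cons.prems(3) by (intro Max.boundedI) auto
  then show ?case using Cons.prems unfolding list.map finish_times.simps
    by (intro Cons.IH) (auto simp: disjoint_iff)
qed simp

section \<open>Bit flips on labels and the layers of a butterfly\<close>

lemma flip_bit_flip_bit [simp]: "flip_bit t (flip_bit t i) = (i :: nat)"
  by (rule bit_eqI) (auto simp: bit_flip_bit_iff)

lemma flip_bit_neq: "flip_bit t i \<noteq> (i :: nat)"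
proof
  assume "flip_bit t i = i"
  then have "bit (flip_bit t i) t = bit i t" by simp
  then show False by (simp add: bit_flip_bit_iff)
qed

lemma flip_bit_less:
  assumes "i < 2 ^ a" "t < a"
  shows "flip_bit t i < (2 :: nat) ^ a"
proof -
  have "take_bit a (flip_bit t i) = flip_bit t (take_bit a i)"
    using assms(2) by (intro bit_eqI) (auto simp: bit_take_bit_iff bit_flip_bit_iff)
  then show ?thesis using assms(1) by (metis take_bit_nat_eq_self take_bit_nat_eq_self_iff)
qed

text \<open>The qubit pairs are the orbits of the involution \<open>flip_bit t\<close>, and the
  filter \<open>i < flip_bit t i\<close> picks one representative of each. The induction runs over
  an arbitrary distinct list of labels.\<close>

lemma butterfly_layer_disjoint:
  "sorted_wrt (\<lambda>g h. set (qubits g) \<inter> set (qubits h) = {}) (butterfly_layer a t \<theta>)"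
proof -
  have "sorted_wrt (\<lambda>g h. set (qubits g) \<inter> set (qubits h) = {})
      [rbs (\<theta> i) i (flip_bit t i). i \<leftarrow> xs, i < flip_bit t i]" if "distinct xs" for xs
    using that
  proof (induction xs)
    case (Cons x xs)
    have "{x, flip_bit t x} \<inter> {j, flip_bit t j} = {}"
      if "x < flip_bit t x" "j \<in> set xs" "j < flip_bit t j" for j
    proof -
      have "x \<noteq> j" using Cons.prems that by auto
      then show ?thesis using that flip_bit_flip_bit[of t x] flip_bit_flip_bit[of t j]
        by (auto simp del: flip_bit_flip_bit)
    qed
    then show ?case using Cons by (fastforce simp: sorted_wrt_append rbs_def split: if_splits)
  qed simp
  then show ?thesis by (simp add: butterfly_layer_def)
qed

lemma depth_butterfly:
  assumes "is_butterfly (2 ^ a) gs"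
  shows "depth (map Op gs) \<le> a"
proof -
  \<comment> \<open>The exponent hidden in \<open>is_butterfly\<close> is \<open>a\<close> because
    powers of two determine their exponents.\<close>
  from assms obtain ts \<theta> where "ts = [0..<a] \<or> ts = rev [0..<a]"
    and gs: "gs = concat (map (\<lambda>t. butterfly_layer a t (\<theta> t)) ts)"
    unfolding is_butterfly_def by auto
  then have len: "length ts = a" by auto
  \<comment> \<open>Each butterfly layer raises the common bound by one; start times and bound are
    generalised so that layers can be chained.\<close>
  have "finish_times (map Op (concat (map (\<lambda>t. butterfly_layer a t (\<theta> t)) ts))) s q \<le> B + length ts"
    if "\<And>q. s q \<le> B" for s B q ts using that
  proof (induction ts arbitrary: s B)
    case (Cons t ts)
    have "finish_times (map Op (butterfly_layer a t (\<theta> t))) s q \<le> Suc B" for q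
      using Cons.prems by (intro finish_times_disjoint_gates butterfly_layer_disjoint) (auto intro: le_SucI)
    from Cons.IH[OF this] show ?case by (simp add: finish_times_append)
  qed simp
  from this[of "\<lambda>_. 0" 0 ts] show ?thesis by (intro depth_leI) (simp add: gs len)
qed

lemma butterfly_rbs_gates:
  assumes "is_butterfly N gs"
  shows "rbs_gates N gs"
proof -
  from assms obtain a ts \<theta> where N: "N = 2 ^ a" and order: "ts = [0..<a] \<or> ts = rev [0..<a]"
    and gs: "gs = concat (map (\<lambda>t. butterfly_layer a t (\<theta> t)) ts)"
    unfolding is_butterfly_def by blast
  from order have ts: "set ts = {..<a}" by auto
  show ?thesis unfolding rbs_gates_def
  proof
    fix g assume "g \<in> set gs"
    then obtain t i where "t < a" "i < 2 ^ a" "g = rbs (\<theta> t i) i (flip_bit t i)"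
      unfolding gs set_concat set_map ts butterfly_layer_def by fastforce
    then show "\<exists>\<theta> p q. p \<noteq> q \<and> p < N \<and> q < N \<and> g = rbs \<theta> p q"
      using flip_bit_less N flip_bit_neq by metis
  qed
qed

lemma rbs_gates_rev: "rbs_gates N (rev gs) = rbs_gates N gs"
  by (simp add: rbs_gates_def)

section \<open>Validity\<close>

lemma valid_circuit_append [simp]:
  "valid_circuit Q (c @ d) \<longleftrightarrow> valid_circuit Q c \<and> valid_circuit Q d"
  by (auto simp: valid_circuit_def)

section \<open>Adjoints and unitarity of the elementary gates\<close>

lemma mat_adjoint_carrier [simp]: "A \<in> carrier_mat m n \<Longrightarrow> mat_adjoint A \<in> carrier_mat n m"
  by (auto simp: mat_adjoint_def)

lemma index_mat_adjoint:
  assumes "A \<in> carrier_mat m n" "i < n" "j < m"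
  shows "mat_adjoint A $$ (i, j) = conjugate (A $$ (j, i))"
  using assms by (auto simp: mat_adjoint_def mat_of_rows_def)

lemma mat_adjoint_adjoint:
  fixes A :: "complex mat"
  assumes "A \<in> carrier_mat m n"
  shows "mat_adjoint (mat_adjoint A) = A"
proof -
  note adj = mat_adjoint_carrier[OF assms]
  note adj2 = mat_adjoint_carrier[OF adj]
  show ?thesis
    by (rule eq_matI) (simp_all add: carrier_matD[OF assms] carrier_matD[OF adj2]
      index_mat_adjoint[OF adj] index_mat_adjoint[OF assms])
qed

text \<open>\<open>unitary_mat\<close> asks for a right inverse; for square matrices it is also a
  left inverse, which is the condition for the adjoint.\<close>

lemma unitary_mat_adjoint:
  assumes "unitary_mat n U"
  shows "unitary_mat n (mat_adjoint U)"
proof -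
  have U: "U \<in> carrier_mat n n" "U * mat_adjoint U = 1\<^sub>m n"
    using assms by (auto simp: unitary_mat_def)
  have "mat_adjoint U * U = 1\<^sub>m n"
    by (rule mat_mult_left_right_inverse[OF U(1) mat_adjoint_carrier[OF U(1)] U(2)])
  then show ?thesis using U by (simp add: unitary_mat_def mat_adjoint_adjoint)
qed

text \<open>Orthonormality of the rows, entry by entry, so that a concrete gate is checked by
  running through its finitely many index pairs.\<close>

lemma unitary_matI:
  assumes "U \<in> carrier_mat n n"
    and "\<And>i j. i < n \<Longrightarrow> j < n \<Longrightarrow> (\<Sum>l<n. U $$ (i, l) * cnj (U $$ (j, l))) = of_bool (i = j)"
  shows "unitary_mat n U"
proof -
  note U = carrier_matD[OF assms(1)] and adj = carrier_matD[OF mat_adjoint_carrier[OF assms(1)]]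
  have eq: "(U * mat_adjoint U) $$ (i, j) = 1\<^sub>m n $$ (i, j)" if "i < n" "j < n" for i j
  proof -
    have "(U * mat_adjoint U) $$ (i, j) = (\<Sum>l<n. U $$ (i, l) * mat_adjoint U $$ (l, j))"
      using that U adj by (simp add: scalar_prod_def atLeast0LessThan)
    also have "\<dots> = (\<Sum>l<n. U $$ (i, l) * cnj (U $$ (j, l)))"
      using that by (intro sum.cong) (simp_all add: index_mat_adjoint[OF assms(1)])
    also have "\<dots> = 1\<^sub>m n $$ (i, j)" using assms(2)[OF that] that by simp
    finally show ?thesis .
  qed
  have "U * mat_adjoint U = 1\<^sub>m n"
    by (rule eq_matI) (use eq U adj in simp_all)
  then show ?thesis using assms(1) by (simp add: unitary_mat_def)
qed

lemma less_4_cases: "(i :: nat) < 4 \<Longrightarrow> i = 0 \<or> i = 1 \<or> i = 2 \<or> i = 3"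
  by auto

lemma valid_gate_rbs:
  assumes "p \<in> Q" "q \<in> Q" "p \<noteq> q"
  shows "valid_gate Q (rbs \<theta> p q)"
proof -
  have "unitary_mat 4 (gate_mat (rbs \<theta> p q))"
  proof (rule unitary_matI)
    fix i j :: nat assume "i < 4" "j < 4"
    from this[THEN less_4_cases] show "(\<Sum>l<4. gate_mat (rbs \<theta> p q) $$ (i, l) * cnj (gate_mat (rbs \<theta> p q) $$ (j, l)))
        = of_bool (i = j)"
      by (elim disjE) (simp_all add: rbs_def mat_of_rows_list_def numeral_eq_Suc of_real_sin_squared)
  qed (rule carrier_matI, simp_all add: rbs_def mat_of_rows_list_def)
  then show ?thesis using assms by (simp add: valid_gate_def rbs_def)
qed

lemma valid_gate_cz:
  assumes "p \<in> Q" "q \<in> Q" "p \<noteq> q"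
  shows "valid_gate Q (cz p q)"
proof -
  have "unitary_mat 4 (gate_mat (cz p q))"
  proof (rule unitary_matI)
    fix i j :: nat assume "i < 4" "j < 4"
    from this[THEN less_4_cases] show "(\<Sum>l<4. gate_mat (cz p q) $$ (i, l) * cnj (gate_mat (cz p q) $$ (j, l)))
        = of_bool (i = j)"
      by (elim disjE) (simp_all add: cz_def mat_of_rows_list_def numeral_eq_Suc)
  qed (rule carrier_matI, simp_all add: cz_def mat_of_rows_list_def)
  then show ?thesis using assms by (simp add: valid_gate_def cz_def)
qed

lemma valid_gate_pauli_x:
  assumes "q \<in> Q"
  shows "valid_gate Q (pauli_x q)"
proof -
  have "unitary_mat 2 (gate_mat (pauli_x q))"
  proof (rule unitary_matI)
    fix i j :: nat assume "i < 2" "j < 2"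
    then have "i = 0 \<or> i = 1" "j = 0 \<or> j = 1" by auto
    then show "(\<Sum>l<2. gate_mat (pauli_x q) $$ (i, l) * cnj (gate_mat (pauli_x q) $$ (j, l)))
        = of_bool (i = j)"
      by (elim disjE) (simp_all add: pauli_x_def mat_of_rows_list_def numeral_eq_Suc)
  qed (rule carrier_matI, simp_all add: pauli_x_def mat_of_rows_list_def)
  then show ?thesis using assms by (simp add: valid_gate_def pauli_x_def)
qed

section \<open>Validity under placement on a register and inversion\<close>

lemma valid_gate_map:
  assumes "valid_gate Q g" "inj f" "f ` Q \<subseteq> R"
  shows "valid_gate R (map_gate f g)"
proof -
  have "f ` set (qubits g) \<subseteq> R" using assms by (auto simp: valid_gate_def)
  then show ?thesis using assms
    by (simp add: valid_gate_def gate.map_sel distinct_map inj_on_subset[OF assms(2)])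
qed

lemma valid_on_upper:
  assumes "rbs_gates N gs"
  shows "valid_circuit ({..<N} <+> R) (on_upper gs)"
proof -
  have "valid_gate ({..<N} <+> R) (map_gate Inl g)" if "g \<in> set gs" for g
  proof (rule valid_gate_map)
    show "valid_gate {..<N} g" using assms that by (auto simp: rbs_gates_def intro!: valid_gate_rbs)
  qed auto
  then show ?thesis by (auto simp: valid_circuit_def on_upper_def)
qed

lemma valid_on_lower:
  assumes "valid_circuit Q c"
  shows "valid_circuit (R <+> Q) (on_lower c)"
proof -
  have "valid_instr (R <+> Q) (lower_instr x)" if "valid_instr Q x" for x
  proof (cases x)
    case (Op g)
    then show ?thesis using that by (auto intro!: valid_gate_map)
  next
    case (Relabel \<pi>)
    then have \<pi>: "\<pi> permutes Q" using that by simp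
    \<comment> \<open>The lift of the inverse permutation is the inverse of the lift.\<close>
    have "bij_betw (map_sum id \<pi>) (R <+> Q) (R <+> Q)"
    proof (rule bij_betwI)
      show "map_sum id \<pi> \<in> (R <+> Q) \<rightarrow> (R <+> Q)"
        "map_sum id (inv_into UNIV \<pi>) \<in> (R <+> Q) \<rightarrow> (R <+> Q)"
        using permutes_in_image[OF \<pi>] permutes_in_image[OF permutes_inv[OF \<pi>]] by auto
    qed (auto simp: permutes_inverses[OF \<pi>])
    moreover have "map_sum id \<pi> y = y" if "y \<notin> R <+> Q" for y
      using that permutes_not_in[OF \<pi>] by (cases y) auto
    ultimately show ?thesis unfolding Relabel by (simp add: bij_imp_permutes)
  qed
  then show ?thesis using assms by (auto simp: valid_circuit_def on_lower_def)
qed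

lemma valid_inverse_circuit:
  assumes "valid_circuit Q c"
  shows "valid_circuit Q (inverse_circuit c)"
proof -
  have "valid_instr Q (inverse_instr x)" if "valid_instr Q x" for x
    using that by (cases x) (auto simp: valid_gate_def unitary_mat_adjoint permutes_inv)
  then show ?thesis using assms by (auto simp: valid_circuit_def inverse_circuit_def)
qed

lemma valid_controlled_uz:
  assumes "Z \<subseteq> {..<N}" "k < M"
  shows "valid_circuit ({..<N} <+> {..<M}) (controlled_uz k Z)"
proof -
  have "finite Z" using assms(1) finite_subset by blast
  then show ?thesis using assms
    by (auto simp: valid_circuit_def controlled_uz_def intro!: valid_gate_pauli_x valid_gate_cz)
qed

section \<open>The parallel quantum Fourier layer\<close>

text \<open>Every stage before the final inverse transform has this form, so those stages are
  tracked through the amplitude matrix alone.\<close>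

definition unary_pair :: "complex mat \<Rightarrow> (nat + nat) state" where
  "unary_pair A = (\<lambda>S. \<Sum>i<dim_row A. \<Sum>j<dim_col A. A $$ (i, j) * tensor (ket {i}) (ket {j}) S)"

text \<open>Grouping by rows suits circuits on the lower register; the grouping by columns below
  suits the upper register and the controlled gates, whose effect depends on the lower
  state.\<close>

lemma unary_pair_rows:
  "unary_pair A = (\<lambda>S. \<Sum>i<dim_row A. tensor (ket {i}) (unary_state (row A i)) S)"
  by (simp add: unary_pair_def unary_state_def[abs_def] tensor_lincomb_right)

lemma unary_pair_cols:
  "unary_pair A = (\<lambda>S. \<Sum>j<dim_col A. tensor (unary_state (col A j)) (ket {j}) S)"
proof -
  have "tensor (unary_state (col A j)) (ket {j}) S
      = (\<Sum>i<dim_row A. A $$ (i, j) * tensor (ket {i}) (ket {j}) S)" if "j < dim_col A" for j S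
    using that by (simp add: unary_state_def[abs_def] tensor_lincomb_left)
  then show ?thesis by (simp add: unary_pair_def fun_eq_iff) (subst sum.swap, simp)
qed

lemma run_on_lower_unary_pair:
  assumes "\<And>i. i < dim_row A \<Longrightarrow> run c (unary_state (row A i)) = unary_state (row B i)"
    and "dim_row B = dim_row A"
  shows "run (on_lower c) (unary_pair A) = unary_pair B"
  using assms by (simp add: unary_pair_rows run_sum run_on_lower)

lemma row_fourier_carrier: "A \<in> carrier_mat m n \<Longrightarrow> row_fourier A \<in> carrier_mat m n"
  by (auto simp: row_fourier_def)

lemma row_row_fourier:
  assumes "A \<in> carrier_mat m n" "i < m"
  shows "row (row_fourier A) i = fourier (row (map_mat complex_of_real A) i)"
proof -
  have "row (row_fourier A) i = fourier (map_vec complex_of_real (row A i))"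
    using assms unfolding row_fourier_def
    by (subst mat_of_rows_row) (auto simp: fourier_def)
  also have "map_vec complex_of_real (row A i) = row (map_mat complex_of_real A) i"
    using assms by auto
  finally show ?thesis .
qed

text \<open>For \<open>j = k\<close> the two unary matrices compose. Otherwise the reversed circuit
  leaves a single \<open>uz\<close>, by \<open>run_rev_uz_run\<close>, and the second controlled
  gate cancels it.\<close>

lemma run_butterfly_pair:
  assumes "finite Z" "rbs_gates N P" "splits_gates Z P" "x \<in> carrier_vec N"
  shows "run (on_upper P @ controlled_uz k Z @ on_upper (rev P) @ controlled_uz k Z)
      (tensor (unary_state x) (ket {j}))
    = tensor (unary_state (if j = k then (unary_matrix N (rev P) * unary_matrix N P) *\<^sub>v x else x))
        (ket {j})"
proof (cases "j = k")
  case True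
  have W: "unary_matrix N gs \<in> carrier_mat N N" for gs by (simp add: unary_matrix_def)
  have "run (map Op (rev P)) (run (map Op P) (unary_state x))
      = unary_state (unary_matrix N (rev P) *\<^sub>v (unary_matrix N P *\<^sub>v x))"
    using assms(2) by (simp add: run_unary_state assms(4) mult_mat_vec_carrier[OF W assms(4)] rbs_gates_rev)
  also have "\<dots> = unary_state ((unary_matrix N (rev P) * unary_matrix N P) *\<^sub>v x)"
    by (simp only: assoc_mult_mat_vec[OF W W assms(4)])
  finally have "run (map Op (rev P)) (run (map Op P) (unary_state x))
      = unary_state ((unary_matrix N (rev P) * unary_matrix N P) *\<^sub>v x)" .
  then show ?thesis using True
    by (simp add: run_on_upper controlled_uz_tensor_ket[OF assms(1)])
next
  case False
  then show ?thesis
    by (simp add: run_on_upper controlled_uz_tensor_ket[OF assms(1)]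
        run_rev_uz_run[OF assms(1-3)])
qed

lemma run_pqf_circuit:
  assumes A: "A \<in> carrier_mat Nc Ns" and load: "is_loading_circuit A load"
    and qft: "is_unary_qft Ns qft" and k: "k < Ns"
    and P: "rbs_gates Nc P" "finite Z" "splits_gates Z P"
  defines "\<A> \<equiv> row_fourier A"
    and "b \<equiv> (unary_matrix Nc (rev P) * unary_matrix Nc P) *\<^sub>v col (row_fourier A) k"
  shows "run (pqf_circuit load qft P Z k) (ket {}) = (\<lambda>S. \<Sum>i<Nc. tensor (ket {i})
     (run (inverse_circuit qft) (\<lambda>T. b $ i * ket {k} T
        + (\<Sum>j\<in>{..<Ns} - {k}. \<A> $$ (i, j) * ket {j} T))) S)"
proof -
  have \<A>: "\<A> \<in> carrier_mat Nc Ns" unfolding \<A>_def by (rule row_fourier_carrier[OF A])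
  have b: "b \<in> carrier_vec Nc" by (rule carrier_vecI) (simp add: b_def unary_matrix_def)
  \<comment> \<open>The amplitudes after the upper block: column \<open>k\<close> is replaced by
    \<open>b\<close>, all others are kept.\<close>
  define B where "B = mat Nc Ns (\<lambda>(i, j). if j = k then b $ i else \<A> $$ (i, j))"
  have col: "col B j = (if j = k then b else col \<A> j)" if "j < Ns" for j
    using that b \<A> by (intro eq_vecI) (auto simp: B_def)
  have 1: "run (map Op load) (ket {}) = unary_pair (map_mat complex_of_real A)"
    using load A by (simp add: is_loading_circuit_def unary_pair_def fun_eq_iff)
  have 2: "run (on_lower qft) (unary_pair (map_mat complex_of_real A)) = unary_pair \<A>"
    using A \<A> qft unfolding \<A>_def
    by (intro run_on_lower_unary_pair) (auto simp: is_unary_qft_def row_row_fourier)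
  have 3: "run (on_upper P @ controlled_uz k Z @ on_upper (rev P) @ controlled_uz k Z)
      (unary_pair \<A>) = unary_pair B"
  proof -
    have "run (on_upper P @ controlled_uz k Z @ on_upper (rev P) @ controlled_uz k Z)
        (tensor (unary_state (col \<A> j)) (ket {j})) = tensor (unary_state (col B j)) (ket {j})"
      if "j < Ns" for j
      unfolding col[OF that] using \<A>
      by (subst run_butterfly_pair[OF P(2,1,3)]) (auto simp: b_def \<A>_def)
    moreover have "dim_col B = Ns" "dim_col \<A> = Ns" using \<A> by (auto simp: B_def)
    ultimately show ?thesis unfolding unary_pair_cols run_sum by simp
  qed
  \<comment> \<open>Back to rows for the inverse transform: splitting off the index \<open>k\<close>
    gives exactly its argument in the claim.\<close>
  have row: "unary_state (row B i) = (\<lambda>T. b $ i * ket {k} T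
      + (\<Sum>j\<in>{..<Ns} - {k}. \<A> $$ (i, j) * ket {j} T))" if "i < Nc" for i
  proof
    fix T
    have "unary_state (row B i) T = (\<Sum>j<Ns. B $$ (i, j) * ket {j} T)"
      using that by (simp add: unary_state_def B_def)
    also have "\<dots> = B $$ (i, k) * ket {k} T + (\<Sum>j\<in>{..<Ns} - {k}. B $$ (i, j) * ket {j} T)"
      using k by (intro sum.remove) auto
    finally show "unary_state (row B i) T = b $ i * ket {k} T
        + (\<Sum>j\<in>{..<Ns} - {k}. \<A> $$ (i, j) * ket {j} T)"
      using that k by (simp add: B_def)
  qed
  have "run (pqf_circuit load qft P Z k) (ket {})
      = run (on_lower (inverse_circuit qft)) (run (on_upper P @ controlled_uz k Z
          @ on_upper (rev P) @ controlled_uz k Z) (run (on_lower qft) (run (map Op load) (ket {}))))"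
    by (simp add: pqf_circuit_def)
  also have "\<dots> = run (on_lower (inverse_circuit qft)) (unary_pair B)"
    by (simp only: 1 2 3)
  also have "\<dots> = (\<lambda>S. \<Sum>i<Nc. tensor (ket {i})
      (run (inverse_circuit qft) (unary_state (row B i))) S)"
    unfolding unary_pair_rows run_sum run_on_lower by (simp add: B_def)
  finally show ?thesis by (simp add: row)
qed

lemma valid_pqf_circuit:
  assumes "A \<in> carrier_mat Nc Ns" "is_loading_circuit A load" "is_unary_qft Ns qft" "k < Ns"
    and "rbs_gates Nc P" "Z \<subseteq> {..<Nc}"
  shows "valid_circuit ({..<Nc} <+> {..<Ns}) (pqf_circuit load qft P Z k)"
  using assms unfolding pqf_circuit_def is_loading_circuit_def is_unary_qft_def
  by (auto intro!: valid_on_upper valid_on_lower valid_inverse_circuit valid_controlled_uz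
      simp: rbs_gates_rev)

text \<open>The transform and its inverse give \<open>2 * depth qft\<close>, the two butterflies
  \<open>2 * a\<close>, and the two controlled blocks, with at most \<open>Nc\<close> CZ gates and
  two X gates each, \<open>2 * (Nc + 2)\<close>.\<close>

lemma depth_pqf_circuit:
  assumes "is_unary_qft Ns qft" "is_butterfly (2 ^ a) P" "Z \<subseteq> {..<Nc}"
  shows "depth (pqf_circuit load qft P Z k)
    \<le> depth (map Op load) + 2 * depth qft + 2 * a + 2 * Nc + 4"
proof -
  have bij: "bij \<pi>" if "Relabel \<pi> \<in> set qft" for \<pi>
    using assms(1) that by (auto simp: is_unary_qft_def valid_circuit_def dest: permutes_bij)
  \<comment> \<open>A relabelling in the inverse circuit is the inverse of one in
    \<open>qft\<close>, hence again bijective, as \<open>depth_on_lower\<close> requires.\<close>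
  have "Relabel \<pi> \<in> set (inverse_circuit qft) \<Longrightarrow> bij \<pi>" for \<pi>
  proof -
    assume "Relabel \<pi> \<in> set (inverse_circuit qft)"
    then obtain x where x: "x \<in> set qft" "Relabel \<pi> = inverse_instr x"
      by (auto simp: inverse_circuit_def)
    show "bij \<pi>"
    proof (cases x)
      case (Relabel \<rho>)
      then have "bij \<rho>" using bij x(1) by blast
      then show ?thesis using Relabel x(2) by (simp add: bij_imp_bij_inv)
    qed (use x(2) in simp)
  qed
  then have "depth (on_lower (inverse_circuit qft)) \<le> depth (inverse_circuit qft)"
    by (rule depth_on_lower)
  also have "\<dots> \<le> depth qft" using bij by (rule depth_inverse_circuit)
  finally have iqft: "depth (on_lower (inverse_circuit qft)) \<le> depth qft" .
  have qft: "depth (on_lower qft) \<le> depth qft" using bij by (rule depth_on_lower)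
  have P: "depth (on_upper P) \<le> a"
    using depth_on_upper[of P] depth_butterfly[OF assms(2)] by linarith
  have P': "depth (on_upper (rev P)) \<le> a"
    using depth_on_upper[of "rev P"] depth_rev[of P] depth_butterfly[OF assms(2)] by linarith
  have "card Z \<le> Nc" using card_mono[OF _ assms(3)] by simp
  \<comment> \<open>The gate count is used as the depth bound: all these gates share the control
    qubit.\<close>
  then have cuz: "depth (controlled_uz k Z) \<le> Nc + 2"
    using depth_le_length[of "controlled_uz k Z"] by (simp add: controlled_uz_def)
  have "depth (pqf_circuit load qft P Z k) \<le> depth (map Op load) + (depth (on_lower qft)
      + (depth (on_upper P) + (depth (controlled_uz k Z) + (depth (on_upper (rev P))
      + (depth (controlled_uz k Z) + depth (on_lower (inverse_circuit qft)))))))"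
    unfolding pqf_circuit_def by (intro order_trans[OF depth_append] add_left_mono order_refl)
  then show ?thesis using iqft qft P P' cuz by linarith
qed

text \<open>Asymptotic bounds are rendered by a constant chosen before all sizes and data. Indices
  start at 0, and \<open>butterfly_splits\<close> provides sets \<open>Z k\<close> as
  required.\<close>

theorem mainTheorem3:
  fixes load :: "real mat \<Rightarrow> (nat + nat) gate list"
    and qft :: "nat \<Rightarrow> nat circuit"
  assumes loading: "\<exists>c. \<forall>Nc Ns A. (\<exists>a. Nc = 2 ^ a) \<and> (\<exists>b. Ns = 2 ^ b) \<and> 2 \<le> Nc \<and> 2 \<le> Ns
      \<and> A \<in> carrier_mat Nc Ns \<and> (\<Sum>i<Nc. \<Sum>j<Ns. (A $$ (i, j))\<^sup>2) = 1
      \<longrightarrow> is_loading_circuit A (load A)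
        \<and> real (depth (map Op (load A))) \<le> c * (log 2 (real Nc) + real Nc * log 2 (real Ns))"
    and fourier_circuit: "\<exists>c. \<forall>M. (\<exists>m. M = 2 ^ m) \<and> 2 \<le> M
      \<longrightarrow> is_unary_qft M (qft M) \<and> real (depth (qft M)) \<le> c * log 2 (real M)"
  shows "\<exists>C. \<forall>Nc Ns K A P Z.
      (\<exists>a. Nc = 2 ^ a) \<and> (\<exists>b. Ns = 2 ^ b) \<and> 2 \<le> Nc \<and> 2 \<le> Ns \<and> 1 \<le> K \<and> K \<le> Ns
      \<and> A \<in> carrier_mat Nc Ns \<and> (\<Sum>i<Nc. \<Sum>j<Ns. (A $$ (i, j))\<^sup>2) = 1
      \<and> (\<forall>k<K. is_butterfly Nc (P k) \<and> Z k \<subseteq> {..<Nc} \<and> splits_gates (Z k) (P k))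
      \<longrightarrow> (let \<A> = row_fourier A;
               W\<^sub>Q = (\<lambda>k. unary_matrix Nc (rev (P k)) * unary_matrix Nc (P k));
               b = (\<lambda>k. W\<^sub>Q k *\<^sub>v col \<A> k);
               IQFT = run (inverse_circuit (qft Ns));
               layer = pqf_layer (load A) (qft Ns) P Z K
           in length layer = K \<and>
              (\<forall>k<K. valid_circuit ({..<Nc} <+> {..<Ns}) (layer ! k)
                \<and> run (layer ! k) (ket {}) =
                    (\<lambda>S. \<Sum>i<Nc. tensor (ket {i})
                       (IQFT (\<lambda>T. b k $ i * ket {k} T
                          + (\<Sum>j\<in>{..<Ns} - {k}. \<A> $$ (i, j) * ket {j} T))) S)
                \<and> real (depth (layer ! k)) \<le> C * (real Nc + real Nc * log 2 (real Ns))))"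
proof -
  obtain c\<^sub>1 where load: "is_loading_circuit A (load A)"
      "real (depth (map Op (load A))) \<le> c\<^sub>1 * (log 2 (real Nc) + real Nc * log 2 (real Ns))"
    if "\<exists>a. Nc = 2 ^ a" "\<exists>b. Ns = 2 ^ b" "2 \<le> Nc" "2 \<le> Ns" "A \<in> carrier_mat Nc Ns"
      "(\<Sum>i<Nc. \<Sum>j<Ns. (A $$ (i, j))\<^sup>2) = 1" for Nc Ns and A :: "real mat"
    using loading by blast
  obtain c\<^sub>2 where fourier: "is_unary_qft M (qft M)" "real (depth (qft M)) \<le> c\<^sub>2 * log 2 (real M)"
    if "\<exists>m. M = 2 ^ m" "2 \<le> M" for M
    using fourier_circuit by blast
  \<comment> \<open>Absolute values guard against negative constants. The 6 absorbs
    \<open>2 * a + 2 * Nc + 4\<close>, since \<open>a \<le> Nc\<close> and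
    \<open>4 \<le> 2 * Nc\<close>.\<close>
  define C where "C = \<bar>c\<^sub>1\<bar> + 2 * \<bar>c\<^sub>2\<bar> + 6"
  have main: "valid_circuit ({..<Nc} <+> {..<Ns}) (pqf_circuit (load A) (qft Ns) P Z k)"
      "run (pqf_circuit (load A) (qft Ns) P Z k) (ket {}) = (\<lambda>S. \<Sum>i<Nc. tensor (ket {i})
         (run (inverse_circuit (qft Ns)) (\<lambda>T.
            ((unary_matrix Nc (rev P) * unary_matrix Nc P) *\<^sub>v col (row_fourier A) k) $ i * ket {k} T
            + (\<Sum>j\<in>{..<Ns} - {k}. row_fourier A $$ (i, j) * ket {j} T))) S)"
      "real (depth (pqf_circuit (load A) (qft Ns) P Z k))
         \<le> C * (real Nc + real Nc * log 2 (real Ns))"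
    if Nc: "\<exists>a. Nc = 2 ^ a" "2 \<le> Nc" and Ns: "\<exists>b. Ns = 2 ^ b" "2 \<le> Ns" and k: "k < Ns"
      and A: "A \<in> carrier_mat Nc Ns" "(\<Sum>i<Nc. \<Sum>j<Ns. (A $$ (i, j))\<^sup>2) = 1"
      and P: "is_butterfly Nc P" and Z: "Z \<subseteq> {..<Nc}" "splits_gates Z P"
    for Nc Ns k and A :: "real mat" and P Z
  proof -
    note load = load[OF Nc(1) Ns(1) Nc(2) Ns(2) A] and fourier = fourier[OF Ns]
    have gates: "rbs_gates Nc P" using P by (rule butterfly_rbs_gates)
    have fin: "finite Z" using Z(1) finite_subset by blast
    show "valid_circuit ({..<Nc} <+> {..<Ns}) (pqf_circuit (load A) (qft Ns) P Z k)"
      using valid_pqf_circuit[OF A(1) load(1) fourier(1) k gates Z(1)] .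
    show "run (pqf_circuit (load A) (qft Ns) P Z k) (ket {}) = (\<lambda>S. \<Sum>i<Nc. tensor (ket {i})
         (run (inverse_circuit (qft Ns)) (\<lambda>T.
            ((unary_matrix Nc (rev P) * unary_matrix Nc P) *\<^sub>v col (row_fourier A) k) $ i * ket {k} T
            + (\<Sum>j\<in>{..<Ns} - {k}. row_fourier A $$ (i, j) * ket {j} T))) S)"
      by (rule run_pqf_circuit[OF A(1) load(1) fourier(1) k gates fin Z(2)])
    from Nc(1) obtain a where a: "Nc = 2 ^ a" ..
    define L where "L = log 2 (real Ns)"
    have L: "1 \<le> L" using Ns(2) by (simp add: L_def le_log_iff)
    \<comment> \<open>This turns the term \<open>log 2 Nc\<close> of the loading bound, which equals
      \<open>a\<close>, into the \<open>Nc\<close> of the claimed bound.\<close>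
    have a_le: "real a \<le> real Nc" using less_exp[of a] by (simp add: a)
    have logNc: "log 2 (real Nc) = real a" by (simp add: a log_nat_power)
    have NcL: "L \<le> real Nc * L" "0 \<le> real Nc * L" using L Nc(2) by simp_all
    then have L_le: "L \<le> real Nc + real Nc * L" by linarith
    have "real (depth (map Op (load A))) \<le> c\<^sub>1 * (real a + real Nc * L)"
      using load(2) by (simp add: logNc L_def)
    also have "\<dots> \<le> \<bar>c\<^sub>1\<bar> * (real Nc + real Nc * L)"
      using a_le NcL by (intro mult_mono) auto
    finally have d1: "real (depth (map Op (load A))) \<le> \<bar>c\<^sub>1\<bar> * (real Nc + real Nc * L)" .
    have "real (depth (qft Ns)) \<le> c\<^sub>2 * L" using fourier(2) by (simp add: L_def)
    also have "\<dots> \<le> \<bar>c\<^sub>2\<bar> * (real Nc + real Nc * L)"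
      using L_le L by (intro mult_mono) auto
    finally have d2: "real (depth (qft Ns)) \<le> \<bar>c\<^sub>2\<bar> * (real Nc + real Nc * L)" .
    have "real (depth (pqf_circuit (load A) (qft Ns) P Z k))
        \<le> real (depth (map Op (load A)) + 2 * depth (qft Ns) + 2 * a + 2 * Nc + 4)"
      using depth_pqf_circuit[OF fourier(1) P[unfolded a] Z(1)] by (simp only: of_nat_le_iff)
    also have "\<dots> = real (depth (map Op (load A))) + 2 * real (depth (qft Ns))
        + 2 * real a + 2 * real Nc + 4" by simp
    also have "\<dots> \<le> \<bar>c\<^sub>1\<bar> * (real Nc + real Nc * L) + 2 * (\<bar>c\<^sub>2\<bar> * (real Nc + real Nc * L))
        + 6 * (real Nc + real Nc * L)"
    proof -
      have "2 \<le> real Nc" using Nc(2) by simp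
      then show ?thesis using d1 d2 a_le NcL(2) by argo
    qed
    also have "\<dots> = C * (real Nc + real Nc * L)"
      by (simp add: C_def algebra_simps)
    finally show "real (depth (pqf_circuit (load A) (qft Ns) P Z k))
         \<le> C * (real Nc + real Nc * log 2 (real Ns))" by (simp add: L_def)
  qed
  show ?thesis
  proof (intro exI[of _ C] allI impI, elim conjE)
    fix Nc Ns K and A :: "real mat" and P Z
    assume Nc: "\<exists>a. Nc = 2 ^ a" "2 \<le> Nc" and Ns: "\<exists>b. Ns = 2 ^ b" "2 \<le> Ns"
      and K: "1 \<le> K" "K \<le> Ns"
      and A: "A \<in> carrier_mat Nc Ns" "(\<Sum>i<Nc. \<Sum>j<Ns. (A $$ (i, j))\<^sup>2) = 1"
      and PZ: "\<forall>k<K. is_butterfly Nc (P k) \<and> Z k \<subseteq> {..<Nc} \<and> splits_gates (Z k) (P k)"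
    have len: "length (pqf_layer (load A) (qft Ns) P Z K) = K" by (simp add: pqf_layer_def)
    have nth: "pqf_layer (load A) (qft Ns) P Z K ! k = pqf_circuit (load A) (qft Ns) (P k) (Z k) k"
      if "k < K" for k using that by (simp add: pqf_layer_def)
    show "let \<A> = row_fourier A;
               W\<^sub>Q = (\<lambda>k. unary_matrix Nc (rev (P k)) * unary_matrix Nc (P k));
               b = (\<lambda>k. W\<^sub>Q k *\<^sub>v col \<A> k);
               IQFT = run (inverse_circuit (qft Ns));
               layer = pqf_layer (load A) (qft Ns) P Z K
           in length layer = K \<and>
              (\<forall>k<K. valid_circuit ({..<Nc} <+> {..<Ns}) (layer ! k)
                \<and> run (layer ! k) (ket {}) =
                    (\<lambda>S. \<Sum>i<Nc. tensor (ket {i})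
                       (IQFT (\<lambda>T. b k $ i * ket {k} T
                          + (\<Sum>j\<in>{..<Ns} - {k}. \<A> $$ (i, j) * ket {j} T))) S)
                \<and> real (depth (layer ! k)) \<le> C * (real Nc + real Nc * log 2 (real Ns)))"
      unfolding Let_def
    proof (intro conjI allI impI len)
      fix k assume k: "k < K"
      then have k': "k < Ns" and PZk: "is_butterfly Nc (P k)" "Z k \<subseteq> {..<Nc}" "splits_gates (Z k) (P k)"
        using K PZ by auto
      note main = main[OF Nc Ns k' A PZk, folded nth[OF k]]
      show "valid_circuit ({..<Nc} <+> {..<Ns}) (pqf_layer (load A) (qft Ns) P Z K ! k)"
        by (rule main)
      show "run (pqf_layer (load A) (qft Ns) P Z K ! k) (ket {}) = (\<lambda>S. \<Sum>i<Nc. tensor (ket {i})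
         (run (inverse_circuit (qft Ns)) (\<lambda>T.
            (unary_matrix Nc (rev (P k)) * unary_matrix Nc (P k) *\<^sub>v col (row_fourier A) k) $ i * ket {k} T
            + (\<Sum>j\<in>{..<Ns} - {k}. row_fourier A $$ (i, j) * ket {j} T))) S)"
        by (rule main)
      show "real (depth (pqf_layer (load A) (qft Ns) P Z K ! k))
         \<le> C * (real Nc + real Nc * log 2 (real Ns))"
        by (rule main)
    qed
  qed
qed

end
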